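(* Let $\mathfrak g$ be the centrally extended planar Galilean conformal algebra (in current form) and $\mathfrak g^*$ its regular dual, as defined in the context. The coadjoint action of $\mathrm{Diff}(S^1)$ on $\mathfrak g^*$ is given as follows: for $\phi\in\mathrm{Diff}(S^1)$ and $\vec\gamma={}^t(\gamma_0,\gamma_1,\gamma_2,\gamma_3,a,b)\in\mathfrak g^*$, the components $a,b$ are unchanged, and the first four components of $\phi(\vec\gamma)$ are $$\begin{pmatrix} a\,\Theta(\phi)+(\gamma_0\circ\phi)(\phi')^2\\ (\gamma_1\circ\phi)(\phi')^2\\ (\gamma_2\circ\phi)(\phi')^2\\ (\gamma_3\circ\phi)\,\phi'\end{pmatrix},\qquad \Theta(\phi)=\frac{\phi'''}{\phi'}-\frac32\Big(\frac{\phi''}{\phi'}\Big)^2,$$ where $\Theta(\phi)$ is the Schwarzian derivative of $\phi$.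
   Context: All functions are smooth real-valued functions on $S^1=\mathbb R/2\pi\mathbb Z$ with coordinate $\theta$; a prime denotes $d/d\theta$. The centerless algebra $\mathfrak g_0$ is the Lie algebra of vector fields spanned by $L_f=f(\theta)\partial_\theta+f'(\theta)\sum_{i=1,2}x_i\partial_{x_i}$, $J_f=f(\theta)(x_1\partial_{x_2}-x_2\partial_{x_1})$, $P^i_f=f(\theta)\partial_{x_i}$ ($i=1,2$), $f\in C^\infty(S^1)$. Its brackets are $$[L_f,L_g]=L_{fg'-f'g},\quad [L_f,P^i_g]=P^i_{fg'-f'g},\quad [L_f,J_g]=J_{fg'},$$ $$[J_f,P^i_g]=-\sum_{k=1,2}\epsilon_{ik}P^k_{fg},\quad [J_f,J_g]=[P^i_f,P^j_g]=0,$$ with $\epsilon_{12}=-\epsilon_{21}=1$, $\epsilon_{11}=\epsilon_{22}=0$. The algebra $\mathfrak g=\mathfrak g_0\oplus\mathbb R\oplus\mathbb R$ is the two-dimensional central extension with central elements $C_1,C_2$ whose brackets are the brackets of $\mathfrak g_0$ except for $$[L_f,L_g]=L_{fg'-f'g}-\Big(\int_{S^1}f'''g\,d\theta\Big)C_1,\qquad [J_f,J_g]=\Big(\int_{S^1}f g'\,d\theta\Big)C_2 .$$ An element of $\mathfrak g$ is $X=L_{f_0}+P^1_{f_1}+P^2_{f_2}+J_{f_3}+\alpha C_1+\beta C_2$ with $\alpha,\beta\in\mathbb R$. The regular dual $\mathfrak g^*$ consists of vectors $\vec\gamma={}^t(\gamma_0,\gamma_1,\gamma_2,\gamma_3,a,b)$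 with $\gamma_i\in C^\infty(S^1)$, $a,b\in\mathbb R$ (standing for $\gamma_0d\theta^2+\gamma_1d\theta^2+\gamma_2d\theta^2+\gamma_3d\theta+a+b$), paired with $\mathfrak g$ by $$\langle\vec\gamma,X\rangle=\sum_{i=0}^3\int_{S^1}\gamma_i f_i\,d\theta+a\alpha+b\beta .$$ $\mathrm{Diff}(S^1)$ denotes the group of orientation-preserving smooth diffeomorphisms of $S^1$, with the multiplication $\phi\cdot\psi=\psi\circ\phi$ (this is the convention compatible with the sign in the bracket $[L_f,L_g]=L_{fg'-f'g}$ of $\mathfrak g_0$). It acts on $\mathfrak g_0$ by automorphisms $\mathrm{Ad}_0(\phi)X=\phi X\phi^{-1}$, namely $$\mathrm{Ad}_0(\phi)L_f=L_{(f\circ\phi)/\phi'},\quad \mathrm{Ad}_0(\phi)P^i_f=P^i_{(f\circ\phi)/\phi'},\quad \mathrm{Ad}_0(\phi)J_f=J_{f\circ\phi}.$$ The adjoint action $\mathrm{Ad}(\phi)$ on $\mathfrak g$ is the unique Lie algebra automorphism of $\mathfrak g$ that fixes $C_1,C_2$ and induces $\mathrm{Ad}_0(\phi)$ on $\mathfrak g/(\mathbb RC_1\oplus\mathbb RC_2)=\mathfrak g_0$. The coadjoint action of $\phi$ on $\gamma\in\mathfrak g^*$ is the element $\phi(\gamma)\in\mathfrak g^*$ determined by $\langle\phi(\gamma),X\rangle=\langle\gamma,\mathrm{Ad}(\phi^{-1})X\rangle$ for all $X\in\mathfrak g$, where $\phi^{-1}$ is the inverse diffeomorphism. *)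

theory Defs
  imports "HOL-Analysis.Analysis" "HOL-Library.Real_Mod"
begin

section \<open>Smooth functions of one real variable\<close>

definition smooth :: "(real \<Rightarrow> real) \<Rightarrow> bool" where
  "smooth f \<longleftrightarrow> (\<forall>n. (deriv ^^ n) f differentiable_on UNIV)"

definition times_diff :: "nat \<Rightarrow> (real \<Rightarrow> real) \<Rightarrow> bool" where
  "times_diff n f \<longleftrightarrow> (\<forall>k<n. (deriv ^^ k) f differentiable_on UNIV)"

lemma smooth_iff_times_diff: "smooth f \<longleftrightarrow> (\<forall>n. times_diff n f)"
  unfolding smooth_def times_diff_def by blast

lemma times_diff_0 [simp]: "times_diff 0 f"
  by (simp add: times_diff_def)

lemma times_diff_Suc: "times_diff (Suc n) f \<longleftrightarrow> f differentiable_on UNIV \<and> times_diff n (deriv f)"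
  unfolding times_diff_def All_less_Suc2 by (simp add: funpow_Suc_right del: funpow.simps(2))

lemma times_diff_SucD: "times_diff (Suc n) f \<Longrightarrow> times_diff n f"
  unfolding times_diff_def by auto

lemma differentiable_on_has_deriv:
  fixes f :: "real \<Rightarrow> real"
  assumes "f differentiable_on UNIV"
  shows "(f has_real_derivative deriv f x) (at x)"
  using assms by (metis DERIV_deriv_iff_real_differentiable differentiable_on_def
      iso_tuple_UNIV_I)

lemma has_deriv_differentiable_on:
  fixes f :: "real \<Rightarrow> real"
  assumes "\<And>x. (f has_real_derivative f' x) (at x)"
  shows "f differentiable_on UNIV" "deriv f = f'"
  using assms by (auto simp: differentiable_on_def real_differentiable_def intro!: DERIV_imp_deriv)

lemma times_diff_SucI:
  assumes "\<And>x. (f has_real_derivative f' x) (at x)" "times_diff n f'"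
  shows "times_diff (Suc n) f"
  using has_deriv_differentiable_on[OF assms(1)] assms(2) by (simp add: times_diff_Suc)

lemma times_diff_has_deriv: "times_diff (Suc n) f \<Longrightarrow> (f has_real_derivative deriv f x) (at x)"
  by (simp add: times_diff_Suc differentiable_on_has_deriv)

lemma times_diff_const: "times_diff n (\<lambda>_. c)"
proof (induction n arbitrary: c)
  case (Suc n)
  show ?case by (rule times_diff_SucI[where f' = "\<lambda>_. 0"]) (use Suc in auto)
qed simp

lemma times_diff_add: "times_diff n f \<Longrightarrow> times_diff n g \<Longrightarrow> times_diff n (\<lambda>x. f x + g x)"
proof (induction n arbitrary: f g)
  case (Suc n)
  have "times_diff n (\<lambda>x. deriv f x + deriv g x)"
    by (intro Suc.IH) (use Suc.prems times_diff_Suc in blast)+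
  then show ?case
    by (rule times_diff_SucI[rotated])
       (rule DERIV_add times_diff_has_deriv[OF Suc.prems(1)] times_diff_has_deriv[OF Suc.prems(2)])+
qed simp

lemma times_diff_mult: "times_diff n f \<Longrightarrow> times_diff n g \<Longrightarrow> times_diff n (\<lambda>x. f x * g x)"
proof (induction n arbitrary: f g)
  case (Suc n)
  have "times_diff n (\<lambda>x. deriv f x * g x + deriv g x * f x)"
    by (intro times_diff_add Suc.IH) (use Suc.prems times_diff_Suc times_diff_SucD in blast)+
  then show ?case
    by (rule times_diff_SucI[rotated])
       (rule DERIV_mult times_diff_has_deriv[OF Suc.prems(1)] times_diff_has_deriv[OF Suc.prems(2)])+
qed simp

lemma times_diff_compose: "times_diff n f \<Longrightarrow> times_diff n g \<Longrightarrow> times_diff n (\<lambda>x. f (g x))"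
proof (induction n arbitrary: f)
  case (Suc n)
  have "times_diff n (deriv f)" "times_diff n g" "times_diff n (deriv g)"
    using Suc.prems times_diff_SucD[OF Suc.prems(2)] by (simp_all add: times_diff_Suc)
  then have "times_diff n (\<lambda>x. deriv f (g x) * deriv g x)"
    by (rule times_diff_mult[OF Suc.IH[of "deriv f"]])
  then show ?case
    by (rule times_diff_SucI[rotated])
       (rule DERIV_chain2 times_diff_has_deriv[OF Suc.prems(1)] times_diff_has_deriv[OF Suc.prems(2)])+
qed simp

lemma times_diff_inverse:
  "times_diff n f \<Longrightarrow> (\<And>x. f x \<noteq> 0) \<Longrightarrow> times_diff n (\<lambda>x. inverse (f x))"
proof (induction n)
  case (Suc n)
  have "times_diff n (\<lambda>x. inverse (f x))"
    using Suc.IH Suc.prems(2) times_diff_SucD[OF Suc.prems(1)] by blast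
  then have "times_diff n (\<lambda>x. (-1) * ((inverse (f x) * deriv f x) * inverse (f x)))"
    by (intro times_diff_mult times_diff_const) (use Suc.prems in \<open>auto simp: times_diff_Suc\<close>)
  moreover have "((\<lambda>x. inverse (f x)) has_real_derivative
      (-1) * ((inverse (f x) * deriv f x) * inverse (f x))) (at x)" for x
    using DERIV_inverse'[OF times_diff_has_deriv[OF Suc.prems(1)] Suc.prems(2)] by simp
  ultimately show ?case
    by (rule times_diff_SucI[rotated])
qed simp

lemma smooth_has_deriv: "smooth f \<Longrightarrow> (f has_real_derivative deriv f x) (at x)"
  unfolding smooth_iff_times_diff by (rule times_diff_has_deriv) (rule spec)

lemma smooth_const [simp]: "smooth (\<lambda>_. c)"
  by (simp add: smooth_iff_times_diff times_diff_const)

lemma smooth_add: "smooth f \<Longrightarrow> smooth g \<Longrightarrow> smooth (\<lambda>x. f x + g x)"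
  by (simp add: smooth_iff_times_diff times_diff_add)

lemma smooth_mult: "smooth f \<Longrightarrow> smooth g \<Longrightarrow> smooth (\<lambda>x. f x * g x)"
  by (simp add: smooth_iff_times_diff times_diff_mult)

lemma smooth_compose: "smooth f \<Longrightarrow> smooth g \<Longrightarrow> smooth (\<lambda>x. f (g x))"
  unfolding smooth_iff_times_diff by (intro allI times_diff_compose[of _ f g]) blast+

lemma smooth_inverse: "smooth f \<Longrightarrow> (\<And>x. f x \<noteq> 0) \<Longrightarrow> smooth (\<lambda>x. inverse (f x))"
  by (simp add: smooth_iff_times_diff times_diff_inverse)

lemma smooth_uminus: "smooth f \<Longrightarrow> smooth (\<lambda>x. - f x)"
  using smooth_mult[OF smooth_const[of "-1"], of f] by simp

lemma smooth_minus: "smooth f \<Longrightarrow> smooth g \<Longrightarrow> smooth (\<lambda>x. f x - g x)"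
  using smooth_add[OF _ smooth_uminus, of f g] by simp

lemma smooth_divide: "smooth f \<Longrightarrow> smooth g \<Longrightarrow> (\<And>x. g x \<noteq> 0) \<Longrightarrow> smooth (\<lambda>x. f x / g x)"
  using smooth_mult[OF _ smooth_inverse, of f g] by (simp add: divide_inverse)

lemma smooth_power: "smooth f \<Longrightarrow> smooth (\<lambda>x. f x ^ n)"
  by (induction n) (auto intro: smooth_mult)

lemma smooth_deriv: "smooth f \<Longrightarrow> smooth (deriv f)"
  unfolding smooth_iff_times_diff using times_diff_Suc by blast

lemma smooth_id: "smooth (\<lambda>x. x)"
  unfolding smooth_iff_times_diff
proof
  fix n show "times_diff n (\<lambda>x. x)"
    by (cases n) (auto intro!: times_diff_SucI[where f' = "\<lambda>_. 1"] times_diff_const)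
qed


section \<open>The circle and its smooth functions\<close>

quotient_type circle = real / "\<lambda>x y. [x = y] (rmod (2 * pi))"
  by (rule equivpI) (simp_all add: reflp_def symp_def transp_def rcong_def)

abbreviation pt :: "real \<Rightarrow> circle" where "pt \<equiv> abs_circle"

lemma pt_eq_iff: "pt x = pt y \<longleftrightarrow> [x = y] (rmod (2 * pi))"
  by (rule circle.abs_eq_iff)

lemma pt_rep [simp]: "pt (rep_circle p) = p"
  by (metis Quotient3_abs_rep Quotient3_circle)

lemma pt_eqE:
  assumes "pt x = pt y"
  obtains k :: int where "x = y + of_int k * (2 * pi)"
proof -
  have "[y = x] (rmod (2 * pi))"
    using assms pt_eq_iff rcong_sym by blast
  then show thesis
    using that unfolding rcong_altdef by blast
qed

lemma pt_plus_period [simp]: "pt (x + of_int k * (2 * pi)) = pt x"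
proof -
  have "[x = x + of_int k * (2 * pi)] (rmod (2 * pi))"
    unfolding rcong_altdef by blast
  then show ?thesis
    using pt_eq_iff rcong_sym by blast
qed

definition circle_smooth :: "(circle \<Rightarrow> real) \<Rightarrow> bool" where
  "circle_smooth f \<longleftrightarrow> smooth (\<lambda>x. f (pt x))"

definition circle_deriv :: "(circle \<Rightarrow> real) \<Rightarrow> circle \<Rightarrow> real" where
  "circle_deriv f p = deriv (\<lambda>x. f (pt x)) (rep_circle p)"

lemma deriv_periodic:
  fixes f g :: "real \<Rightarrow> real"
  assumes "\<And>x. f (x + c) = f x + d"
  shows "deriv f (x + c) = deriv f x"
proof -
  have "(f has_real_derivative D) (at (x + c)) \<longleftrightarrow> (f has_real_derivative D) (at x)" for D
  proof -
    have "(f has_real_derivative D) (at (x + c)) \<longleftrightarrow> ((\<lambda>x. f (x + c)) has_real_derivative D) (at x)"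
      by (simp add: DERIV_shift)
    also have "\<dots> \<longleftrightarrow> ((\<lambda>x. f x + d) has_real_derivative D) (at x)"
      by (simp add: assms)
    also have "\<dots> \<longleftrightarrow> (f has_real_derivative D) (at x)"
      using DERIV_add[of "\<lambda>x. f x + d" D x UNIV "\<lambda>_. -d" 0] DERIV_add[of f D x UNIV "\<lambda>_. d" 0]
      by auto
    finally show ?thesis .
  qed
  then show ?thesis by (simp add: deriv_def)
qed

lemma deriv_rep_pt:
  assumes "\<And>x k::int. f (x + of_int k * (2 * pi)) = f x + (d k :: real)"
  shows "deriv f (rep_circle (pt x)) = deriv f x"
proof -
  obtain k :: int where "rep_circle (pt x) = x + of_int k * (2 * pi)"
    using pt_rep pt_eqE by metis
  then show ?thesis using deriv_periodic[of f, OF assms] by simp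
qed

lemma circle_deriv_pt: "circle_deriv f (pt x) = deriv (\<lambda>x. f (pt x)) x"
  unfolding circle_deriv_def by (rule deriv_rep_pt[where d = "\<lambda>_. 0"]) simp

lemma circle_smooth_deriv: "circle_smooth f \<Longrightarrow> circle_smooth (circle_deriv f)"
  unfolding circle_smooth_def circle_deriv_pt by (rule smooth_deriv)

typedef cinf = "{f. circle_smooth f}"
  by (rule exI[of _ "\<lambda>_. 0"]) (simp add: circle_smooth_def)

setup_lifting type_definition_cinf

instantiation cinf :: comm_ring_1
begin
lift_definition zero_cinf :: cinf is "\<lambda>_. 0" by (simp add: circle_smooth_def)
lift_definition one_cinf :: cinf is "\<lambda>_. 1" by (simp add: circle_smooth_def)
lift_definition plus_cinf :: "cinf \<Rightarrow> cinf \<Rightarrow> cinf" is "\<lambda>f g p. f p + g p"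
  by (simp add: circle_smooth_def smooth_add)
lift_definition minus_cinf :: "cinf \<Rightarrow> cinf \<Rightarrow> cinf" is "\<lambda>f g p. f p - g p"
  by (simp add: circle_smooth_def smooth_minus)
lift_definition uminus_cinf :: "cinf \<Rightarrow> cinf" is "\<lambda>f p. - f p"
  by (simp add: circle_smooth_def smooth_uminus)
lift_definition times_cinf :: "cinf \<Rightarrow> cinf \<Rightarrow> cinf" is "\<lambda>f g p. f p * g p"
  by (simp add: circle_smooth_def smooth_mult)
instance
  by standard (transfer; auto simp: algebra_simps fun_eq_iff)+
end

instantiation cinf :: real_algebra_1
begin
lift_definition scaleR_cinf :: "real \<Rightarrow> cinf \<Rightarrow> cinf" is "\<lambda>c f p. c * f p"
  by (simp add: circle_smooth_def smooth_mult)
instance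
  by standard (transfer; auto simp: algebra_simps fun_eq_iff)+
end

lift_definition D :: "cinf \<Rightarrow> cinf" is circle_deriv
  by (rule circle_smooth_deriv)

lift_definition circle_integral :: "cinf \<Rightarrow> real" is
  "\<lambda>f. integral {0..2 * pi} (\<lambda>x. f (pt x))" .


section \<open>Orientation-preserving diffeomorphisms of the circle\<close>

text \<open>Group multiplication is \<open>\<phi> \<cdot> \<psi> = \<psi> \<circ> \<phi>\<close>; inverses are the same for either order of composition.\<close>

definition smooth_lift :: "(real \<Rightarrow> real) \<Rightarrow> (circle \<Rightarrow> circle) \<Rightarrow> bool" where
  "smooth_lift F \<phi> \<longleftrightarrow> smooth F \<and> (\<forall>x. \<phi> (pt x) = pt (F x))"

typedef circle_diffeo =
  "{\<phi>. bij \<phi> \<and> (\<exists>F. smooth_lift F \<phi> \<and> (\<forall>x. deriv F x > 0)) \<and> (\<exists>G. smooth_lift G (inv \<phi>))}"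
  by (rule exI[of _ id]) (auto simp: smooth_lift_def inv_id smooth_id intro!: exI[of _ "\<lambda>x. x"])

setup_lifting type_definition_circle_diffeo

text \<open>Two smooth lifts of the same map differ by a constant, so the derivative below does not
  depend on the lift.\<close>

definition map_deriv :: "(circle \<Rightarrow> circle) \<Rightarrow> circle \<Rightarrow> real" where
  "map_deriv \<phi> p = deriv (SOME F. smooth_lift F \<phi>) (rep_circle p)"

lemma smooth_continuous: "smooth F \<Longrightarrow> continuous_on UNIV F"
  by (meson DERIV_isCont continuous_at_imp_continuous_on smooth_has_deriv)

lemma lifts_differ_by_const:
  assumes F: "smooth F" and G: "smooth G" and eq: "\<And>x. pt (F x) = pt (G x)"
  obtains c where "\<And>x. F x = G x + c"
proof -
  define H where "H = (\<lambda>x. (F x - G x) / (2 * pi))"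
  have int: "H x \<in> \<int>" for x
  proof -
    obtain k :: int where "F x = G x + of_int k * (2 * pi)"
      using pt_eqE[OF eq[of x]] by blast
    then have "H x = of_int k" unfolding H_def by simp
    then show ?thesis by simp
  qed
  have "continuous_on UNIV H"
    unfolding H_def by (intro continuous_intros smooth_continuous F G) auto
  then have "H constant_on UNIV"
  proof (rule continuous_discrete_range_constant[OF connected_UNIV])
    show "\<exists>e>0. \<forall>y. y \<in> UNIV \<and> H y \<noteq> H x \<longrightarrow> e \<le> norm (H y - H x)" if "x \<in> UNIV" for x
      using int by (intro exI[of _ 1]) (auto intro!: Ints_nonzero_abs_ge1 Ints_diff)
  qed
  then obtain c where c: "\<And>x. H x = c" unfolding constant_on_def by blast
  have "F x = G x + 2 * pi * c" for x
    using c[of x] unfolding H_def by (simp add: field_simps)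
  then show thesis using that by blast
qed

lemma deriv_plus_const: "smooth G \<Longrightarrow> deriv (\<lambda>x. G x + c) = deriv G"
proof (rule has_deriv_differentiable_on(2))
  show "((\<lambda>x. G x + c) has_real_derivative deriv G x) (at x)" if "smooth G" for x
    using DERIV_add[OF smooth_has_deriv[OF that] DERIV_const[of c]] by simp
qed

lemma map_deriv_pt:
  assumes F: "smooth_lift F \<phi>"
  shows "map_deriv \<phi> (pt x) = deriv F x"
proof -
  define G where "G = (SOME F. smooth_lift F \<phi>)"
  have G: "smooth_lift G \<phi>" unfolding G_def using someI[of "\<lambda>F. smooth_lift F \<phi>", OF F] .
  obtain c where "\<And>x. G x = F x + c"
    using lifts_differ_by_const[of G F] F G unfolding smooth_lift_def by metis
  then have "G = (\<lambda>x. F x + c)" by auto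
  then have dG: "deriv G = deriv F"
    using F by (simp add: deriv_plus_const smooth_lift_def)
  have "\<exists>d. \<forall>x. F (x + of_int k * (2 * pi)) = F x + d" for k :: int
  proof -
    have "smooth (\<lambda>x. F (x + of_int k * (2 * pi)))"
      using F smooth_compose[of F, OF _ smooth_add[OF smooth_id smooth_const]]
      by (simp add: smooth_lift_def)
    moreover have "pt (F (x + of_int k * (2 * pi))) = pt (F x)" for x
      using F unfolding smooth_lift_def by (metis pt_plus_period)
    ultimately show ?thesis
      using lifts_differ_by_const[of "\<lambda>x. F (x + of_int k * (2 * pi))" F] F
      unfolding smooth_lift_def by metis
  qed
  then obtain d where "\<And>x k::int. F (x + of_int k * (2 * pi)) = F x + d k" by metis
  then have "deriv F (rep_circle (pt x)) = deriv F x" by (rule deriv_rep_pt)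
  then show ?thesis unfolding map_deriv_def G_def[symmetric] dG .
qed

lemma diffeo_lift:
  assumes "\<exists>F. smooth_lift F \<phi> \<and> (\<forall>x. deriv F x > 0)"
  obtains F where "smooth F" "\<And>x. \<phi> (pt x) = pt (F x)" "\<And>x. deriv F x > 0"
    "\<And>x. map_deriv \<phi> (pt x) = deriv F x"
proof -
  obtain F where F: "smooth_lift F \<phi>" "\<And>x. deriv F x > 0"
    using assms by blast
  then have "smooth F" "\<And>x. \<phi> (pt x) = pt (F x)"
    by (simp_all add: smooth_lift_def)
  then show thesis
    using that[OF _ _ F(2) map_deriv_pt[OF F(1)]] by simp
qed

lift_definition diffeo_inv :: "circle_diffeo \<Rightarrow> circle_diffeo" is inv
proof -
  fix \<phi> :: "circle \<Rightarrow> circle"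
  assume \<phi>: "bij \<phi> \<and> (\<exists>F. smooth_lift F \<phi> \<and> (\<forall>x. deriv F x > 0)) \<and> (\<exists>G. smooth_lift G (inv \<phi>))"
  then obtain F G where F: "smooth_lift F \<phi>" "\<And>x. deriv F x > 0" and G: "smooth_lift G (inv \<phi>)"
    by blast
  have sF: "smooth F" and sG: "smooth G" using F G by (auto simp: smooth_lift_def)
  have "pt (F (G x)) = pt x" for x
    using F G \<phi> unfolding smooth_lift_def by (metis bij_inv_eq_iff)
  then obtain c where "\<And>x. F (G x) = x + c"
    using lifts_differ_by_const[of "\<lambda>x. F (G x)" "\<lambda>x. x"] smooth_compose[OF sF sG] smooth_id by metis
  then have FG: "(\<lambda>x. F (G x)) = (\<lambda>x. x + c)" by auto
  have "deriv G x > 0" for x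
  proof -
    have "((\<lambda>x. F (G x)) has_real_derivative deriv F (G x) * deriv G x) (at x)"
      by (intro DERIV_chain2 smooth_has_deriv sF sG)
    moreover have "((\<lambda>x. F (G x)) has_real_derivative 1) (at x)"
      unfolding FG by (auto intro!: derivative_eq_intros)
    ultimately have "deriv F (G x) * deriv G x = 1" by (rule DERIV_unique)
    then show ?thesis using F(2)[of "G x"] by (metis zero_less_mult_pos zero_less_one)
  qed
  moreover have "inv (inv \<phi>) = \<phi>"
    using \<phi> inv_inv_eq by blast
  ultimately show "bij (inv \<phi>) \<and> (\<exists>F. smooth_lift F (inv \<phi>) \<and> (\<forall>x. deriv F x > 0)) \<and>
      (\<exists>G. smooth_lift G (inv (inv \<phi>)))"
    using \<phi> F(1) G bij_imp_bij_inv by metis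
qed

lift_definition diffeo_deriv :: "circle_diffeo \<Rightarrow> cinf" is map_deriv
  by (elim conjE diffeo_lift) (simp add: circle_smooth_def smooth_deriv)

lift_definition pullback :: "cinf \<Rightarrow> circle_diffeo \<Rightarrow> cinf" is "\<lambda>f \<phi> p. f (\<phi> p)"
proof (elim conjE diffeo_lift)
  fix f \<phi> F
  assume "circle_smooth f" "smooth F" "\<And>x. \<phi> (pt x) = pt (F x)"
  then show "circle_smooth (\<lambda>p. f (\<phi> p))"
    using smooth_compose[of "\<lambda>x. f (pt x)" F] by (simp add: circle_smooth_def)
qed

lift_definition vec_pullback :: "cinf \<Rightarrow> circle_diffeo \<Rightarrow> cinf" is
  "\<lambda>f \<phi> p. f (\<phi> p) / map_deriv \<phi> p"
proof (elim conjE diffeo_lift)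
  fix f \<phi> F
  assume "circle_smooth f" "smooth F" "\<And>x. \<phi> (pt x) = pt (F x)" "\<And>x. 0 < deriv F x"
    "\<And>x. map_deriv \<phi> (pt x) = deriv F x"
  then show "circle_smooth (\<lambda>p. f (\<phi> p) / map_deriv \<phi> p)"
    using smooth_divide[OF smooth_compose[of "\<lambda>x. f (pt x)" F] smooth_deriv[of F]]
    by (simp add: circle_smooth_def less_imp_neq[symmetric])
qed

lift_definition schwarzian :: "circle_diffeo \<Rightarrow> cinf" is
  "\<lambda>\<phi> p. circle_deriv (circle_deriv (map_deriv \<phi>)) p / map_deriv \<phi> p
        - 3 / 2 * (circle_deriv (map_deriv \<phi>) p / map_deriv \<phi> p)\<^sup>2"
proof (elim conjE diffeo_lift)
  fix \<phi> F
  assume "smooth F" "\<And>x. 0 < deriv F x" "\<And>x. map_deriv \<phi> (pt x) = deriv F x"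
  then show "circle_smooth (\<lambda>p. circle_deriv (circle_deriv (map_deriv \<phi>)) p / map_deriv \<phi> p
        - 3 / 2 * (circle_deriv (map_deriv \<phi>) p / map_deriv \<phi> p)\<^sup>2)"
    unfolding circle_smooth_def circle_deriv_pt
    by (simp add: smooth_minus smooth_mult smooth_power smooth_divide smooth_deriv
        less_imp_neq[symmetric])
qed


section \<open>The planar Galilean conformal algebra\<close>

text \<open>The vector fields \<open>L f = f \<partial>\<^sub>\<theta> + f' (x\<^sub>1 \<partial>\<^sub>1 + x\<^sub>2 \<partial>\<^sub>2)\<close>, \<open>P\<^sup>i f = f \<partial>\<^sub>i\<close> and
  \<open>J f = f (x\<^sub>1 \<partial>\<^sub>2 - x\<^sub>2 \<partial>\<^sub>1)\<close> are linearly independent, so elements are encoded by their coefficients.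
  The tuple \<open>(f\<^sub>0, f\<^sub>1, f\<^sub>2, f\<^sub>3)\<close> stands for
  \<open>L f\<^sub>0 + P\<^sup>1 f\<^sub>1 + P\<^sup>2 f\<^sub>2 + J f\<^sub>3\<close>, and \<open>(x, \<alpha>, \<beta>)\<close> for \<open>x + \<alpha> C\<^sub>1 + \<beta> C\<^sub>2\<close>.\<close>

type_synonym gca0 = "cinf \<times> cinf \<times> cinf \<times> cinf"
type_synonym gca = "gca0 \<times> real \<times> real"

fun bracket0 :: "gca0 \<Rightarrow> gca0 \<Rightarrow> gca0" where
  "bracket0 (f0, f1, f2, f3) (g0, g1, g2, g3) =
    (f0 * D g0 - D f0 * g0,
     (f0 * D g1 - D f0 * g1) - (g0 * D f1 - D g0 * f1) + (f3 * g2 - g3 * f2),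
     (f0 * D g2 - D f0 * g2) - (g0 * D f2 - D g0 * f2) - (f3 * g1 - g3 * f1),
     f0 * D g3 - g0 * D f3)"

fun cocycle1 :: "gca0 \<Rightarrow> gca0 \<Rightarrow> real" where
  "cocycle1 (f0, f1, f2, f3) (g0, g1, g2, g3) = - circle_integral (D (D (D f0)) * g0)"

fun cocycle2 :: "gca0 \<Rightarrow> gca0 \<Rightarrow> real" where
  "cocycle2 (f0, f1, f2, f3) (g0, g1, g2, g3) = circle_integral (f3 * D g3)"

definition bracket :: "gca \<Rightarrow> gca \<Rightarrow> gca" where
  "bracket X Y = (bracket0 (fst X) (fst Y), cocycle1 (fst X) (fst Y), cocycle2 (fst X) (fst Y))"

definition L :: "cinf \<Rightarrow> gca" where "L f = ((f, 0, 0, 0), 0, 0)"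
definition P1 :: "cinf \<Rightarrow> gca" where "P1 f = ((0, f, 0, 0), 0, 0)"
definition P2 :: "cinf \<Rightarrow> gca" where "P2 f = ((0, 0, f, 0), 0, 0)"
definition J :: "cinf \<Rightarrow> gca" where "J f = ((0, 0, 0, f), 0, 0)"
definition C1 :: gca where "C1 = (0, 1, 0)"
definition C2 :: gca where "C2 = (0, 0, 1)"

lemma D_zero [simp]: "D 0 = 0"
  by transfer (simp add: circle_deriv_def fun_eq_iff)

lemma circle_integral_zero [simp]: "circle_integral 0 = 0"
  by transfer simp

lemma gca_decomposition:
  "((f0, f1, f2, f3), \<alpha>, \<beta>) = L f0 + P1 f1 + P2 f2 + J f3 + \<alpha> *\<^sub>R C1 + \<beta> *\<^sub>R C2"
  by (simp add: L_def P1_def P2_def J_def C1_def C2_def zero_prod_def)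

lemma bracket_generators:
  "bracket (L f) (L g) = L (f * D g - D f * g) - circle_integral (D (D (D f)) * g) *\<^sub>R C1"
  "bracket (L f) (P1 g) = P1 (f * D g - D f * g)"
  "bracket (L f) (P2 g) = P2 (f * D g - D f * g)"
  "bracket (L f) (J g) = J (f * D g)"
  "bracket (J f) (P1 g) = - P2 (f * g)"
  "bracket (J f) (P2 g) = P1 (f * g)"
  "bracket (J f) (J g) = circle_integral (f * D g) *\<^sub>R C2"
  "bracket (P1 f) (P1 g) = 0" "bracket (P1 f) (P2 g) = 0" "bracket (P2 f) (P2 g) = 0"
  "bracket X C1 = 0" "bracket X C2 = 0"
  by (cases X; auto simp: bracket_def L_def P1_def P2_def J_def C1_def C2_def zero_prod_def)+

text \<open>The bracket is the bilinear antisymmetric extension of the relations above.\<close>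

definition gca_automorphism :: "(gca \<Rightarrow> gca) \<Rightarrow> bool" where
  "gca_automorphism A \<longleftrightarrow> linear A \<and> bij A \<and> (\<forall>X Y. A (bracket X Y) = bracket (A X) (A Y))"


section \<open>Adjoint and coadjoint action of the diffeomorphism group\<close>

fun Ad0 :: "circle_diffeo \<Rightarrow> gca0 \<Rightarrow> gca0" where
  "Ad0 \<phi> (f0, f1, f2, f3) =
    (vec_pullback f0 \<phi>, vec_pullback f1 \<phi>, vec_pullback f2 \<phi>, pullback f3 \<phi>)"

text \<open>\<open>Ad \<phi>\<close> is the automorphism that fixes the centre and induces \<open>Ad0 \<phi>\<close> on the quotient by it;
  \<open>fst\<close> is the quotient map.\<close>

definition Ad :: "circle_diffeo \<Rightarrow> gca \<Rightarrow> gca" where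
  "Ad \<phi> = (THE A. gca_automorphism A \<and> A C1 = C1 \<and> A C2 = C2 \<and> (\<forall>X. fst (A X) = Ad0 \<phi> (fst X)))"

type_synonym gca_dual = "(cinf \<times> cinf \<times> cinf \<times> cinf) \<times> real \<times> real"

fun pairing :: "gca_dual \<Rightarrow> gca \<Rightarrow> real" where
  "pairing ((\<gamma>0, \<gamma>1, \<gamma>2, \<gamma>3), a, b) ((f0, f1, f2, f3), \<alpha>, \<beta>) =
    circle_integral (\<gamma>0 * f0) + circle_integral (\<gamma>1 * f1) + circle_integral (\<gamma>2 * f2)
      + circle_integral (\<gamma>3 * f3) + a * \<alpha> + b * \<beta>"

definition coadjoint :: "circle_diffeo \<Rightarrow> gca_dual \<Rightarrow> gca_dual" where
  "coadjoint \<phi> \<gamma> = (THE \<eta>. \<forall>X. pairing \<eta> X = pairing \<gamma> (Ad (diffeo_inv \<phi>) X))"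

end

theory Submission
  imports Defs
begin

text \<open>Write \<open>F = (f \<circ> \<phi>) / \<phi>'\<close> for the pullback of a vector field. Differentiating three times gives
  \<open>(f''' \<circ> \<phi>) \<phi>'\<^sup>2 = F''' + 2 \<Theta>(\<phi>) F' + \<Theta>(\<phi>)' F\<close>, so substitution and integration by parts show
  that pulling back changes the cocycle \<open>- \<integral> f''' g\<close> by the coboundary of the functional
  \<open>F \<mapsto> - \<integral> \<Theta>(\<phi>) F\<close>. This functional corrects \<open>Ad0 \<phi>\<close> to an automorphism, whose inverse corrects
  \<open>Ad0 \<phi>\<^sup>-\<^sup>1\<close> by \<open>f \<mapsto> \<integral> \<Theta>(\<phi>) f\<close>. The correction is unique because every generator is, up to the
  centre, a combination of brackets, and dualizing it yields the Schwarzian term.\<close>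

section \<open>Calculus on the circle\<close>

lemma circle_fun_eqI: "(\<And>x. f (pt x) = g (pt x)) \<Longrightarrow> f = g"
  by (metis ext pt_rep)

lemma circle_smooth_has_deriv:
  "circle_smooth f \<Longrightarrow> ((\<lambda>x. f (pt x)) has_real_derivative circle_deriv f (pt x)) (at x)"
  unfolding circle_smooth_def circle_deriv_pt by (rule smooth_has_deriv)

lemma circle_deriv_eqI:
  "((\<lambda>x. f (pt x)) has_real_derivative c) (at x) \<Longrightarrow> circle_deriv f (pt x) = c"
  unfolding circle_deriv_pt by (rule DERIV_imp_deriv)

lemma circle_continuous:
  "circle_smooth f \<Longrightarrow> continuous_on A (\<lambda>x. f (pt x))"
  unfolding circle_smooth_def by (blast intro: continuous_on_subset smooth_continuous)

lemma circle_integrable: "circle_smooth f \<Longrightarrow> (\<lambda>x. f (pt x)) integrable_on {a..b}"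
  by (intro integrable_continuous_real circle_continuous)

lemma pt_add_2pi: "pt (x + 2 * pi) = pt x"
  using pt_plus_period[of x 1] by simp

lemma D_add: "D (f + g) = D f + D g"
  by transfer (intro circle_fun_eqI circle_deriv_eqI DERIV_add circle_smooth_has_deriv)

lemma D_scaleR: "D (c *\<^sub>R f) = c *\<^sub>R D f"
  by transfer (intro circle_fun_eqI circle_deriv_eqI DERIV_cmult circle_smooth_has_deriv)

lemma D_minus: "D (- f) = - D f"
  using D_scaleR[of "-1" f] by simp

lemma D_diff: "D (f - g) = D f - D g"
  using D_add[of f "- g"] by (simp add: D_minus)

lemma D_mult: "D (f * g) = D f * g + f * D g"
proof transfer
  fix f g assume f: "circle_smooth f" and g: "circle_smooth g"
  show "circle_deriv (\<lambda>p. f p * g p) = (\<lambda>p. circle_deriv f p * g p + f p * circle_deriv g p)"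
    using DERIV_mult'[OF circle_smooth_has_deriv[OF f] circle_smooth_has_deriv[OF g]]
    by (intro circle_fun_eqI circle_deriv_eqI) (simp add: add.commute)
qed

lemma D_one: "D 1 = 0"
  using D_mult[of 1 1] by simp

lemma circle_integral_add: "circle_integral (f + g) = circle_integral f + circle_integral g"
  by transfer (intro integral_add circle_integrable)

lemma circle_integral_scaleR: "circle_integral (c *\<^sub>R f) = c * circle_integral f"
  by transfer simp

lemma circle_integral_diff: "circle_integral (f - g) = circle_integral f - circle_integral g"
  by transfer (intro integral_diff circle_integrable)

text \<open>The endpoints of the period are the same point of the circle, so the boundary terms of
  the fundamental theorem cancel.\<close>

lemma circle_integral_D: "circle_integral (D f) = 0"
proof transfer
  fix f assume f: "circle_smooth f"
  have "((\<lambda>x. circle_deriv f (pt x)) has_integral f (pt (2 * pi)) - f (pt 0)) {0..2 * pi}"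
    using circle_smooth_has_deriv[OF f]
    by (intro fundamental_theorem_of_calculus)
      (auto simp: has_real_derivative_iff_has_vector_derivative[symmetric]
        intro: has_field_derivative_at_within)
  then show "integral {0..2 * pi} (\<lambda>x. circle_deriv f (pt x)) = 0"
    using pt_add_2pi[of 0] by (simp add: integral_unique)
qed

lemma circle_integral_by_parts: "circle_integral (D f * g) = - circle_integral (f * D g)"
  using circle_integral_D[of "f * g"] by (simp add: D_mult circle_integral_add)

section \<open>Nondegeneracy of the integral pairing\<close>

lemma circle_point_in_period: "\<exists>x\<in>{0..2 * pi}. p = pt x"
proof -
  define x where "x = rep_circle p"
  define k where "k = \<lfloor>x / (2 * pi)\<rfloor>"
  have "of_int k \<le> x / (2 * pi)" "x / (2 * pi) < of_int k + 1"
    unfolding k_def by linarith+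
  then have "x + of_int (- k) * (2 * pi) \<in> {0..2 * pi}"
    by (simp add: field_simps)
  moreover have "p = pt (x + of_int (- k) * (2 * pi))"
    unfolding pt_plus_period x_def by simp
  ultimately show ?thesis by blast
qed

text \<open>A continuous nonnegative integrand with zero integral vanishes on the closed period,
  which covers the circle.\<close>

lemma circle_integral_square_eq_0:
  assumes "circle_integral (f * f) = 0"
  shows "f = 0"
  using assms
proof transfer
  fix f assume f: "circle_smooth f" and "integral {0..2 * pi} (\<lambda>x. f (pt x) * f (pt x)) = 0"
  then have "f (pt x) * f (pt x) = 0" if "x \<in> {0..2 * pi}" for x
    using integral_eq_0_iff[of 0 "2 * pi" "\<lambda>x. f (pt x) * f (pt x)"] that
    by (simp add: continuous_on_mult circle_continuous)
  then show "f = (\<lambda>_. 0)"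
    using circle_point_in_period by (metis mult_eq_0_iff)
qed

lemma circle_integral_nondegenerate:
  assumes "\<And>h. circle_integral (f * h) = circle_integral (g * h)"
  shows "f = g"
proof -
  have "circle_integral ((f - g) * (f - g)) = 0"
    using assms[of "f - g"] by (simp add: left_diff_distrib circle_integral_diff)
  then show ?thesis
    using circle_integral_square_eq_0 by fastforce
qed

section \<open>Sine and cosine as functions on the circle\<close>

lemma smooth_sin_cos: "smooth (sin :: real \<Rightarrow> real)" "smooth (cos :: real \<Rightarrow> real)"
proof -
  \<comment> \<open>The induction treats both functions at once, since each is the derivative of the
    other up to sign.\<close>
  have "times_diff n (sin :: real \<Rightarrow> real) \<and> times_diff n (cos :: real \<Rightarrow> real)" for n
  proof (induction n)
    case (Suc n)
    then have "times_diff n (\<lambda>x::real. - 1 * sin x)"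
      by (intro times_diff_mult times_diff_const) auto
    with Suc show ?case
      by (auto intro!: times_diff_SucI[of sin cos] times_diff_SucI[of cos "\<lambda>x. - sin x"]
          derivative_eq_intros)
  qed simp
  then show "smooth (sin :: real \<Rightarrow> real)" "smooth (cos :: real \<Rightarrow> real)"
    by (simp_all add: smooth_iff_times_diff)
qed

lemma sin_cos_rep_circle:
  "sin (rep_circle (pt x)) = sin x" "cos (rep_circle (pt x)) = cos x"
proof -
  obtain k :: int where "rep_circle (pt x) = x + of_int k * (2 * pi)"
    using pt_rep pt_eqE by metis
  then have k: "rep_circle (pt x) = x + 2 * pi * of_int k"
    by simp
  show "sin (rep_circle (pt x)) = sin x" "cos (rep_circle (pt x)) = cos x"
    unfolding k by (simp_all add: sin_add cos_add)
qed

text \<open>By periodicity the choice of representative is immaterial. Sine and cosine later serve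
  to write generators as combinations of brackets.\<close>

lift_definition circle_sin :: cinf is "\<lambda>p. sin (rep_circle p)"
  by (simp add: circle_smooth_def sin_cos_rep_circle smooth_sin_cos)

lift_definition circle_cos :: cinf is "\<lambda>p. cos (rep_circle p)"
  by (simp add: circle_smooth_def sin_cos_rep_circle smooth_sin_cos)

lemma Rep_cinf_power: "Rep_cinf (f ^ n) p = Rep_cinf f p ^ n"
  by (induction n) (simp_all add: one_cinf.rep_eq times_cinf.rep_eq)

lemmas Rep_cinf_simps = plus_cinf.rep_eq minus_cinf.rep_eq uminus_cinf.rep_eq times_cinf.rep_eq
  scaleR_cinf.rep_eq one_cinf.rep_eq zero_cinf.rep_eq Rep_cinf_power

lemma cinf_eqI: "(\<And>p. Rep_cinf f p = Rep_cinf g p) \<Longrightarrow> f = g"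
  by (simp add: Rep_cinf_inject[symmetric] fun_eq_iff)

text \<open>Smooth functions on the circle have zero divisors, whereas \<open>algebra\<close> needs an integral
  domain; hence the pointwise rules.\<close>

lemma cinf_eqI_unit:
  assumes "e * d = 1"
    and "\<And>p. Rep_cinf e p * Rep_cinf d p = 1 \<Longrightarrow> Rep_cinf f p = Rep_cinf g p"
  shows "f = g"
  using assms by (metis cinf_eqI one_cinf.rep_eq times_cinf.rep_eq)

lemma cinf_eqI_sin_cos:
  assumes "\<And>p. (Rep_cinf circle_cos p)\<^sup>2 + (Rep_cinf circle_sin p)\<^sup>2 = 1
      \<Longrightarrow> Rep_cinf f p = Rep_cinf g p"
  shows "f = g"
  by (intro cinf_eqI assms) (simp add: circle_cos.rep_eq circle_sin.rep_eq)

lemma D_circle_sin: "D circle_sin = circle_cos"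
  by transfer (intro circle_fun_eqI circle_deriv_eqI, simp add: sin_cos_rep_circle)

lemma D_circle_cos: "D circle_cos = - circle_sin"
  by transfer (intro circle_fun_eqI circle_deriv_eqI, simp add: sin_cos_rep_circle)


section \<open>Pullback along a diffeomorphism\<close>

lemma pullback_mult: "pullback (f * g) \<phi> = pullback f \<phi> * pullback g \<phi>"
  and pullback_add: "pullback (f + g) \<phi> = pullback f \<phi> + pullback g \<phi>"
  and pullback_diff: "pullback (f - g) \<phi> = pullback f \<phi> - pullback g \<phi>"
  and pullback_one: "pullback 1 \<phi> = 1"
  and pullback_scaleR: "pullback (c *\<^sub>R f) \<phi> = c *\<^sub>R pullback f \<phi>"
  by (transfer, simp)+

lemma pullback_inv: "pullback (pullback f (diffeo_inv \<phi>)) \<phi> = f"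
  "pullback (pullback f \<phi>) (diffeo_inv \<phi>) = f"
  by (transfer, auto simp: bij_def fun_eq_iff surj_f_inv_f)+

lemma D_pullback: "D (pullback f \<phi>) = pullback (D f) \<phi> * diffeo_deriv \<phi>"
proof (transfer, elim conjE diffeo_lift)
  fix f \<phi> F
  assume f: "circle_smooth f" and F: "smooth F" "\<And>x. \<phi> (pt x) = pt (F x)"
    "\<And>x. map_deriv \<phi> (pt x) = deriv F x"
  show "circle_deriv (\<lambda>p. f (\<phi> p)) = (\<lambda>p. circle_deriv f (\<phi> p) * map_deriv \<phi> p)"
    by (intro circle_fun_eqI circle_deriv_eqI)
      (simp add: F DERIV_chain2[OF circle_smooth_has_deriv[OF f] smooth_has_deriv])
qed

text \<open>Makes \<open>vec_pullback 1 \<phi>\<close> the reciprocal of the derivative, so that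
  quotients become ring expressions in \<open>cinf\<close>.\<close>

lemma vec_pullback_one: "vec_pullback 1 \<phi> * diffeo_deriv \<phi> = 1"
proof (transfer, elim conjE diffeo_lift)
  fix \<phi> F
  assume F: "\<And>x. 0 < deriv F x" "\<And>x. map_deriv \<phi> (pt x) = deriv F x"
  show "(\<lambda>p. 1 / map_deriv \<phi> p * map_deriv \<phi> p) = (\<lambda>_. 1)"
    by (intro circle_fun_eqI) (simp add: F less_imp_neq[symmetric])
qed

lemma vec_pullback_eq: "vec_pullback f \<phi> = pullback f \<phi> * vec_pullback 1 \<phi>"
  by transfer simp

lemma vec_pullback_deriv: "vec_pullback f \<phi> * diffeo_deriv \<phi> = pullback f \<phi>"
  using vec_pullback_one[of \<phi>] by (simp add: vec_pullback_eq[of f] mult.assoc)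

lemma schwarzian_eq:
  "schwarzian \<phi> = D (D (diffeo_deriv \<phi>)) * vec_pullback 1 \<phi>
    - (3 / 2) *\<^sub>R (D (diffeo_deriv \<phi>) * vec_pullback 1 \<phi>)\<^sup>2"
  unfolding power2_eq_square by transfer (simp add: power2_eq_square)

lemma vec_pullback_add: "vec_pullback (f + g) \<phi> = vec_pullback f \<phi> + vec_pullback g \<phi>"
  and vec_pullback_diff: "vec_pullback (f - g) \<phi> = vec_pullback f \<phi> - vec_pullback g \<phi>"
  and vec_pullback_scaleR: "vec_pullback (c *\<^sub>R f) \<phi> = c *\<^sub>R vec_pullback f \<phi>"
  and vec_pullback_mult: "vec_pullback (f * g) \<phi> = pullback f \<phi> * vec_pullback g \<phi>"
  by (transfer, simp add: add_divide_distrib diff_divide_distrib)+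

text \<open>The composite of lifts of two mutually inverse maps lifts the identity, so it is a
  translation and has derivative 1; the chain rule gives the product.\<close>

lemma pullback_deriv_inv: "pullback (diffeo_deriv (diffeo_inv \<phi>)) \<phi> * diffeo_deriv \<phi> = 1"
  "pullback (diffeo_deriv \<phi>) (diffeo_inv \<phi>) * diffeo_deriv (diffeo_inv \<phi>) = 1"
proof -
  have *: "map_deriv \<psi> (\<phi> p) * map_deriv \<phi> p = 1"
    if F: "smooth_lift F \<phi>" and G: "smooth_lift G \<psi>" and inv: "\<And>p. \<psi> (\<phi> p) = p" for F G \<phi> \<psi> p
  proof -
    have sF: "smooth F" and sG: "smooth G" using F G by (auto simp: smooth_lift_def)
    have "pt (G (F x)) = pt x" for x
      using F G inv unfolding smooth_lift_def by metis
    then obtain c where "\<And>x. G (F x) = x + c"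
      using lifts_differ_by_const[of "\<lambda>x. G (F x)" "\<lambda>x. x"] smooth_compose[OF sG sF] smooth_id
      by metis
    then have GF: "(\<lambda>x. G (F x)) = (\<lambda>x. x + c)" by auto
    obtain x where x: "p = pt x" by (metis pt_rep)
    have "((\<lambda>x. G (F x)) has_real_derivative deriv G (F x) * deriv F x) (at x)"
      by (intro DERIV_chain2 smooth_has_deriv sF sG)
    moreover have "((\<lambda>x. G (F x)) has_real_derivative 1) (at x)"
      unfolding GF by (auto intro!: derivative_eq_intros)
    ultimately have "deriv G (F x) * deriv F x = 1" by (rule DERIV_unique)
    then show ?thesis
      using F G map_deriv_pt[OF F] map_deriv_pt[OF G] by (simp add: x smooth_lift_def)
  qed
  show "pullback (diffeo_deriv (diffeo_inv \<phi>)) \<phi> * diffeo_deriv \<phi> = 1"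
    by transfer (auto simp: bij_def fun_eq_iff intro!: *)
  show "pullback (diffeo_deriv \<phi>) (diffeo_inv \<phi>) * diffeo_deriv (diffeo_inv \<phi>) = 1"
    by transfer (auto simp: bij_def fun_eq_iff surj_f_inv_f intro!: *)
qed

lemma vec_pullback_inv: "vec_pullback (vec_pullback f (diffeo_inv \<phi>)) \<phi> = f"
  "vec_pullback (vec_pullback f \<phi>) (diffeo_inv \<phi>) = f"
proof -
  have *: "vec_pullback (vec_pullback f \<psi>) \<phi> = f"
    if "pullback (pullback f \<psi>) \<phi> = f" "pullback (diffeo_deriv \<psi>) \<phi> * diffeo_deriv \<phi> = 1" for \<phi> \<psi>
  proof -
    let ?e = "vec_pullback 1 \<phi>"
    \<comment> \<open>The last factor is 1. It is inserted so that each derivative can be grouped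
      with the reciprocal that it cancels.\<close>
    have "vec_pullback (vec_pullback f \<psi>) \<phi>
        = pullback (vec_pullback f \<psi>) \<phi> * ?e * (pullback (diffeo_deriv \<psi>) \<phi> * diffeo_deriv \<phi>)"
      by (subst vec_pullback_eq) (simp add: that(2))
    also have "\<dots> = pullback (vec_pullback f \<psi> * diffeo_deriv \<psi>) \<phi> * (?e * diffeo_deriv \<phi>)"
      by (simp add: pullback_mult mult_ac)
    also have "\<dots> = f"
      by (simp add: vec_pullback_deriv vec_pullback_one pullback_one that(1))
    finally show ?thesis .
  qed
  show "vec_pullback (vec_pullback f (diffeo_inv \<phi>)) \<phi> = f"
    "vec_pullback (vec_pullback f \<phi>) (diffeo_inv \<phi>) = f"
    by (intro * pullback_inv pullback_deriv_inv)+
qed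

text \<open>Going once around changes the increasing lift by a positive multiple \<open>k\<close> of
  the period. If \<open>k\<close> exceeded 1, the intermediate value theorem would give a point
  strictly inside the period with the same image as \<open>pt 0\<close>, against
  injectivity.\<close>

lemma lift_degree_one:
  assumes inj: "inj \<phi>" and F: "smooth F" "\<And>x. \<phi> (pt x) = pt (F x)" "\<And>x. deriv F x > 0"
  shows "F (2 * pi) = F 0 + 2 * pi"
proof -
  have mono: "F x < F y" if "x < y" for x y
    using that by (rule DERIV_pos_imp_increasing) (use F smooth_has_deriv in blast)
  have "pt (F (2 * pi)) = pt (F 0)"
    using pt_add_2pi[of 0] by (simp flip: F(2))
  then obtain k :: int where k: "F (2 * pi) = F 0 + of_int k * (2 * pi)"
    using pt_eqE by blast
  have "of_int k * (2 * pi) > 0"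
    using mono[of 0 "2 * pi"] k by simp
  then have "k \<ge> 1"
    by (simp add: zero_less_mult_iff)
  moreover have "k \<le> 1"
  proof (rule ccontr)
    assume "\<not> k \<le> 1"
    then have "1 * (2 * pi) < of_int k * (2 * pi)"
      by (intro mult_strict_right_mono) auto
    then have lt: "F 0 + 2 * pi < F (2 * pi)"
      using k by simp
    then obtain x where x: "0 \<le> x" "x \<le> 2 * pi" "F x = F 0 + 2 * pi"
      using IVT'[of F 0 "F 0 + 2 * pi" "2 * pi"] continuous_on_subset[OF smooth_continuous[OF F(1)]]
      by auto
    then have "pt (F x) = pt (F 0)"
      by (simp add: pt_add_2pi)
    then have "pt x = pt 0"
      using inj by (simp add: inj_eq flip: F(2))
    then obtain j :: int where "x = 0 + of_int j * (2 * pi)"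
      by (rule pt_eqE)
    then have j: "x = of_int j * (2 * pi)"
      by simp
    have "x \<noteq> 0" "x \<noteq> 2 * pi" using x lt by auto
    then have "0 < x" "x < 1 * (2 * pi)"
      using x by auto
    then have "0 < j" "j < 1"
      unfolding j by (simp_all add: zero_less_mult_iff)
    then show False by simp
  qed
  ultimately show ?thesis using k by simp
qed

text \<open>Change of variables on the lift, which by \<open>lift_degree_one\<close> carries one
  period onto an interval of the same length.\<close>

lemma circle_integral_pullback:
  "circle_integral (pullback f \<phi> * diffeo_deriv \<phi>) = circle_integral f"
proof (transfer, elim conjE diffeo_lift)
  fix f \<phi> F
  assume f: "circle_smooth f" and F: "smooth F" "\<And>x. \<phi> (pt x) = pt (F x)" "\<And>x. 0 < deriv F x"
    "\<And>x. map_deriv \<phi> (pt x) = deriv F x" and "bij \<phi>"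
  then have deg: "F (2 * pi) = F 0 + 2 * pi"
    using lift_degree_one bij_is_inj by blast
  have "isCont (\<lambda>x. f (pt x)) x" for x
    using circle_smooth_has_deriv[OF f] DERIV_isCont by blast
  then obtain H where H: "\<And>x. (H has_real_derivative f (pt x)) (at x)"
    using einterval_antiderivative[of "-\<infinity>" "\<infinity>" "\<lambda>x. f (pt x)"]
    by (auto simp: has_real_derivative_iff_has_vector_derivative)
  \<comment> \<open>The increment of the antiderivative \<open>H\<close> over one period has
    derivative 0, so it is the same from \<open>F 0\<close> as from 0.\<close>
  have "((\<lambda>x. H (x + 2 * pi) - H x) has_real_derivative f (pt (x + 2 * pi)) - f (pt x)) (at x)" for x
    using DERIV_diff[OF iffD1[OF DERIV_shift H[of "x + 2 * pi"]] H[of x]] .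
  then have "((\<lambda>x. H (x + 2 * pi) - H x) has_real_derivative 0) (at x)" for x
    by (simp add: pt_add_2pi)
  then have per: "H (F 0 + 2 * pi) - H (F 0) = H (0 + 2 * pi) - H 0"
    using DERIV_isconst_all[of "\<lambda>x. H (x + 2 * pi) - H x"] by blast
  have FTC: "integral {0..2 * pi} h = K (2 * pi) - K 0"
    if "\<And>x. (K has_real_derivative h x) (at x)" for K h
    using that
    by (intro integral_unique fundamental_theorem_of_calculus)
      (auto simp: has_real_derivative_iff_has_vector_derivative[symmetric]
        intro: has_field_derivative_at_within)
  have "integral {0..2 * pi} (\<lambda>x. f (pt (F x)) * deriv F x) = H (F (2 * pi)) - H (F 0)"
    by (rule FTC) (intro DERIV_chain2 H smooth_has_deriv F)
  also have "\<dots> = integral {0..2 * pi} (\<lambda>x. f (pt x))"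
    using FTC[OF H] per deg by simp
  finally show "integral {0..2 * pi} (\<lambda>x. f (\<phi> (pt x)) * map_deriv \<phi> (pt x))
      = integral {0..2 * pi} (\<lambda>x. f (pt x))"
    by (simp add: F)
qed


section \<open>The Schwarzian cocycle\<close>

lemma D_vec_pullback_one:
  "D (vec_pullback 1 \<phi>) = - D (diffeo_deriv \<phi>) * vec_pullback 1 \<phi> * vec_pullback 1 \<phi>"
proof -
  let ?e = "vec_pullback 1 \<phi>" and ?d = "diffeo_deriv \<phi>"
  have "D ?e * ?d + ?e * D ?d = 0"
    using arg_cong[OF vec_pullback_one[of \<phi>], of D] by (simp add: D_mult D_one)
  \<comment> \<open>Solves the differentiated relation \<open>?e * ?d = 1\<close> for
    \<open>D ?e\<close> by multiplying it with \<open>?e\<close>.\<close>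
  moreover have "D ?e = (D ?e * ?d + ?e * D ?d) * ?e - D ?d * ?e * ?e"
    by (rule cinf_eqI_unit[OF vec_pullback_one[of \<phi>]], unfold Rep_cinf_simps) algebra
  ultimately show ?thesis by simp
qed

lemma D_vec_pullback:
  "D (vec_pullback f \<phi>) =
    pullback (D f) \<phi> - pullback f \<phi> * D (diffeo_deriv \<phi>) * (vec_pullback 1 \<phi>)\<^sup>2"
  unfolding vec_pullback_eq[of f] D_mult D_pullback D_vec_pullback_one
  by (rule cinf_eqI_unit[OF vec_pullback_one[of \<phi>]], unfold Rep_cinf_simps) algebra

text \<open>The terms containing the second derivative of \<open>\<phi>\<close> are symmetric in
  \<open>f\<close> and \<open>g\<close> and cancel in the antisymmetric bracket.\<close>

lemma vec_pullback_bracket: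
  "vec_pullback (f * D g - D f * g) \<phi> =
    vec_pullback f \<phi> * D (vec_pullback g \<phi>) - D (vec_pullback f \<phi>) * vec_pullback g \<phi>"
  unfolding D_vec_pullback
  unfolding vec_pullback_eq[of f] vec_pullback_eq[of g] vec_pullback_eq[of "f * D g - D f * g"] pullback_diff pullback_mult
  by (rule cinf_eqI, unfold Rep_cinf_simps) algebra

text \<open>The third derivative maps vector fields to quadratic differentials; the Schwarzian terms
  measure its failure to commute with pullback.\<close>

lemma third_derivative_vec_pullback:
  fixes f \<phi> defines "F \<equiv> vec_pullback f \<phi>"
  shows "pullback (D (D (D f))) \<phi> * (diffeo_deriv \<phi>)\<^sup>2 =
    D (D (D F)) + 2 *\<^sub>R (schwarzian \<phi> * D F) + D (schwarzian \<phi>) * F"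
proof -
  \<comment> \<open>Everything becomes a polynomial in \<open>e\<close>, in \<open>d\<close> and its
    derivatives, and in the pulled back derivatives of \<open>f\<close>, subject to
    \<open>e * d = 1\<close>. The rules below keep such polynomials closed under
    \<open>D\<close>.\<close>
  define d e where "d = diffeo_deriv \<phi>" and "e = vec_pullback 1 \<phi>"
  define d1 d2 d3 where "d1 = D d" and "d2 = D d1" and "d3 = D d2"
  define u u1 u2 u3 where "u = pullback f \<phi>" and "u1 = pullback (D f) \<phi>"
    and "u2 = pullback (D (D f)) \<phi>" and "u3 = pullback (D (D (D f))) \<phi>"
  have ed: "e * d = 1"
    by (simp add: e_def d_def vec_pullback_one)
  have "D e = - d1 * e * e" "D u = u1 * d" "D u1 = u2 * d" "D u2 = u3 * d"
    "D d = d1" "D d1 = d2" "D d2 = d3"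
    by (simp_all add: e_def d_def d1_def d2_def d3_def u_def u1_def u2_def u3_def
        D_vec_pullback_one D_pullback)
  note D_eqs = power2_eq_square power3_eq_cube D_mult D_diff D_add D_scaleR this
  have S: "schwarzian \<phi> = d2 * e - (3 / 2) *\<^sub>R (d1 * e)\<^sup>2"
    by (simp add: schwarzian_eq e_def d2_def d1_def d_def)
  have DS: "D (schwarzian \<phi>) = d3 * e - 4 *\<^sub>R (d2 * d1 * e\<^sup>2) + 3 *\<^sub>R (d1 ^ 3 * e ^ 3)"
    unfolding S D_eqs by (rule cinf_eqI, unfold Rep_cinf_simps) algebra
  have F: "F = u * e"
    by (simp add: F_def u_def e_def vec_pullback_eq[of f])
  have F1: "D F = u1 - u * d1 * e\<^sup>2"
    by (simp add: F_def D_vec_pullback u_def u1_def d1_def d_def e_def)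
  have F2: "D (D F) = u2 * d - u1 * d1 * e - u * d2 * e\<^sup>2 + 2 *\<^sub>R (u * d1\<^sup>2 * e ^ 3)"
    unfolding F1 D_eqs by (rule cinf_eqI_unit[OF ed], unfold Rep_cinf_simps) algebra
  have F3: "D (D (D F)) = u3 * d\<^sup>2 - 2 *\<^sub>R (u1 * d2 * e) + 3 *\<^sub>R (u1 * d1\<^sup>2 * e\<^sup>2)
      - u * d3 * e\<^sup>2 + 6 *\<^sub>R (u * d1 * d2 * e ^ 3) - 6 *\<^sub>R (u * d1 ^ 3 * e ^ 4)"
    unfolding F2 D_eqs by (rule cinf_eqI_unit[OF ed], unfold Rep_cinf_simps) algebra
  have "u3 * d\<^sup>2 = D (D (D F)) + 2 *\<^sub>R (schwarzian \<phi> * D F) + D (schwarzian \<phi>) * F"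
    \<comment> \<open>Highest derivatives go first: replacing \<open>F\<close> or
      \<open>schwarzian \<phi>\<close> earlier would destroy the left-hand sides of the other
      equations.\<close>
    unfolding F3 DS unfolding F1 unfolding F S
    by (rule cinf_eqI, unfold Rep_cinf_simps) algebra
  then show ?thesis
    by (simp add: u3_def d_def)
qed

text \<open>Integrating the term with \<open>D (schwarzian \<phi>)\<close> by parts cancels one of
  the two copies of \<open>schwarzian \<phi> * (D F * G)\<close> and supplies the other half of the
  bracket of \<open>F\<close> and \<open>G\<close>.\<close>

lemma schwarzian_cocycle:
  fixes f g \<phi> defines "F \<equiv> vec_pullback f \<phi>" and "G \<equiv> vec_pullback g \<phi>"
  shows "circle_integral (D (D (D F)) * G) =
    circle_integral (D (D (D f)) * g) + circle_integral (schwarzian \<phi> * (F * D G - D F * G))"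
proof -
  let ?d = "diffeo_deriv \<phi>" and ?S = "schwarzian \<phi>"
  \<comment> \<open>Substitution yields one factor \<open>?d\<close>; writing the pullback of
    \<open>g\<close> as \<open>G * ?d\<close> yields the second.\<close>
  have "circle_integral (D (D (D f)) * g) = circle_integral (pullback (D (D (D f))) \<phi> * ?d\<^sup>2 * G)"
    unfolding circle_integral_pullback[of "D (D (D f)) * g" \<phi>, symmetric] pullback_mult G_def
      vec_pullback_deriv[of g, symmetric] by (simp add: power2_eq_square mult_ac)
  also have "pullback (D (D (D f))) \<phi> * ?d\<^sup>2 * G
      = D (D (D F)) * G + (D ?S * (F * G) + (?S * (D F * G) + ?S * (D F * G)))"
    unfolding third_derivative_vec_pullback F_def[symmetric]
    by (simp add: scaleR_2 algebra_simps)
  finally have "circle_integral (D (D (D f)) * g) = circle_integral (D (D (D F)) * G)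
      + (circle_integral (D ?S * (F * G))
        + (circle_integral (?S * (D F * G)) + circle_integral (?S * (D F * G))))"
    by (simp only: circle_integral_add)
  moreover have "circle_integral (D ?S * (F * G)) =
      - (circle_integral (?S * (D F * G)) + circle_integral (?S * (F * D G)))"
    by (simp only: circle_integral_by_parts D_mult distrib_left circle_integral_add)
  ultimately show ?thesis
    by (simp add: right_diff_distrib circle_integral_diff)
qed


section \<open>The adjoint action\<close>

lemma linear_Ad0: "linear (Ad0 \<phi>)"
  by (rule linearI) (auto simp: pullback_add pullback_scaleR vec_pullback_add vec_pullback_scaleR)

lemma Ad0_inv: "Ad0 (diffeo_inv \<phi>) (Ad0 \<phi> x) = x" "Ad0 \<phi> (Ad0 (diffeo_inv \<phi>) x) = x"
  by (cases x; simp add: pullback_inv vec_pullback_inv)+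

lemma Ad0_zero: "Ad0 \<phi> 0 = 0"
  using linear_Ad0 linear_0 by blast

lemma Ad0_bracket0: "Ad0 \<phi> (bracket0 x y) = bracket0 (Ad0 \<phi> x) (Ad0 \<phi> y)"
proof -
  \<comment> \<open>The derivative of \<open>\<phi>\<close> from the chain rule cancels the
    denominator of the pulled back vector field.\<close>
  have *: "pullback (f * D g) \<phi> = vec_pullback f \<phi> * D (pullback g \<phi>)" for f g
    by (simp add: pullback_mult D_pullback vec_pullback_deriv[of f, symmetric] mult_ac)
  obtain f0 f1 f2 f3 g0 g1 g2 g3 where "x = (f0, f1, f2, f3)" "y = (g0, g1, g2, g3)"
    by (cases x; cases y)
  \<comment> \<open>These patterns split the sums only as far as the blocks
    \<open>f * D g - D f * g\<close>, which must stay whole for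
    \<open>vec_pullback_bracket\<close>.\<close>
  moreover have "vec_pullback (k + (f3 * g - g3 * f)) \<phi> = vec_pullback k \<phi> +
      (pullback f3 \<phi> * vec_pullback g \<phi> - pullback g3 \<phi> * vec_pullback f \<phi>)"
    "vec_pullback (k - (f3 * g - g3 * f)) \<phi> = vec_pullback k \<phi> -
      (pullback f3 \<phi> * vec_pullback g \<phi> - pullback g3 \<phi> * vec_pullback f \<phi>)" for k f g
    by (simp_all only: vec_pullback_add vec_pullback_diff vec_pullback_mult)
  moreover have "vec_pullback ((f * D g - D f * g) - (f' * D g' - D f' * g')) \<phi> =
      vec_pullback (f * D g - D f * g) \<phi> - vec_pullback (f' * D g' - D f' * g') \<phi>" for f g f' g'
    by (rule vec_pullback_diff)
  ultimately show ?thesis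
    by (simp only: Ad0.simps bracket0.simps vec_pullback_bracket pullback_diff *)
qed

text \<open>The functional whose coboundary is the change of the first cocycle; it sees only the
  \<open>L\<close> component.\<close>

definition schwarzian_form :: "circle_diffeo \<Rightarrow> gca0 \<Rightarrow> real" where
  "schwarzian_form \<phi> x = circle_integral (schwarzian \<phi> * fst x)"

lemma linear_schwarzian_form: "linear (schwarzian_form \<phi>)"
  by (rule linearI)
    (simp_all add: schwarzian_form_def distrib_left circle_integral_add circle_integral_scaleR)

text \<open>The first component of the transformed bracket is the bracket of the pulled back fields,
  so this is \<open>schwarzian_cocycle\<close> with the sign of \<open>cocycle1\<close>.\<close>

lemma cocycle1_Ad0:
  "cocycle1 (Ad0 \<phi> x) (Ad0 \<phi> y) =
    cocycle1 x y - schwarzian_form \<phi> (Ad0 \<phi> (bracket0 x y))"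
  by (cases x; cases y) (simp add: schwarzian_form_def vec_pullback_bracket schwarzian_cocycle)

text \<open>The integrand \<open>f * D g\<close> transforms as a one-form, whose integral is
  invariant under substitution.\<close>

lemma cocycle2_Ad0: "cocycle2 (Ad0 \<phi> x) (Ad0 \<phi> y) = cocycle2 x y"
proof -
  have "circle_integral (pullback f \<phi> * D (pullback g \<phi>)) = circle_integral (f * D g)" for f g
    using circle_integral_pullback[of "f * D g" \<phi>]
    by (simp add: pullback_mult D_pullback mult.assoc)
  then show ?thesis
    by (cases x; cases y) simp
qed

text \<open>The set where \<open>A\<close> and \<open>B\<close> agree is a subspace containing all
  brackets and the centre, and these span the algebra.\<close>

lemma automorphism_eqI:
  assumes A: "gca_automorphism A" "A C1 = C1" "A C2 = C2"
    and B: "gca_automorphism B" "B C1 = C1" "B C2 = C2"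
    and fst: "\<And>X. fst (A X) = fst (B X)"
  shows "A = B"
proof
  fix X :: gca
  have lin: "linear A" "linear B"
    using A B by (simp_all add: gca_automorphism_def)
  let ?E = "{X. A X = B X}"
  have E: "subspace ?E"
    using lin by (auto simp: subspace_def linear_0 linear_add linear_scale)
  \<comment> \<open>A bracket depends on its arguments only modulo the centre, where
    \<open>A\<close> and \<open>B\<close> agree by assumption.\<close>
  have br: "bracket X Y \<in> ?E" for X Y
  proof -
    have "A (bracket X Y) = bracket (A X) (A Y)" "B (bracket X Y) = bracket (B X) (B Y)"
      using A(1) B(1) unfolding gca_automorphism_def by blast+
    then show ?thesis using fst by (simp add: bracket_def)
  qed
  have C: "C1 \<in> ?E" "C2 \<in> ?E" using A B by simp_all
  let ?s = circle_sin and ?c = circle_cos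
  \<comment> \<open>As \<open>cos sin' - sin cos' = 1\<close>, both \<open>[f cos, sin] - [f sin, cos] = 2 f\<close> for the bracket of
    vector fields and \<open>f cos sin' - f sin cos' = f\<close>.\<close>
  have id2: "(f * ?c * D ?s - D (f * ?c) * ?s) - (f * ?s * D ?c - D (f * ?s) * ?c) = 2 *\<^sub>R f" for f
  proof -
    have "(f * ?c * D ?s - D (f * ?c) * ?s) - (f * ?s * D ?c - D (f * ?s) * ?c) = f + f"
      unfolding D_mult D_circle_sin D_circle_cos
      by (rule cinf_eqI_sin_cos, unfold Rep_cinf_simps) algebra
    then show ?thesis by (simp add: scaleR_2)
  qed
  have id1: "f * ?c * D ?s - f * ?s * D ?c = f" for f
    unfolding D_circle_sin D_circle_cos
    by (rule cinf_eqI_sin_cos, unfold Rep_cinf_simps) algebra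
  have half: "Y \<in> ?E" if "2 *\<^sub>R Y \<in> ?E" for Y
    using subspace_scale[OF E that, of "1 / 2"] by simp
  have L: "L f \<in> ?E" for f
  proof (rule half)
    let ?Y = "bracket (L (f * ?c)) (L ?s) - bracket (L (f * ?s)) (L ?c)"
    have "fst ?Y = fst (2 *\<^sub>R L f)"
      using id2[of f] by (simp add: bracket_generators) (simp add: L_def C1_def zero_prod_def)
    moreover have "snd (snd ?Y) = 0"
      by (simp add: bracket_def L_def)
    \<comment> \<open>Brackets of two \<open>L\<close> elements may carry a multiple of
      \<open>C1\<close>; it is subtracted, as \<open>C1\<close> lies in \<open>?E\<close>.\<close>
    ultimately have eq: "2 *\<^sub>R L f = ?Y - fst (snd ?Y) *\<^sub>R C1"
      by (simp add: prod_eq_iff C1_def L_def)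
    show "2 *\<^sub>R L f \<in> ?E"
      unfolding eq by (intro subspace_diff[OF E] subspace_scale[OF E] br C)
  qed
  have P1: "P1 f \<in> ?E" for f
  proof (rule half)
    have eq: "2 *\<^sub>R P1 f = bracket (L (f * ?c)) (P1 ?s) - bracket (L (f * ?s)) (P1 ?c)"
      using id2[of f] unfolding bracket_generators by (simp add: P1_def zero_prod_def)
    show "2 *\<^sub>R P1 f \<in> ?E"
      unfolding eq by (intro subspace_diff[OF E] br)
  qed
  have P2: "P2 f \<in> ?E" for f
  proof (rule half)
    have eq: "2 *\<^sub>R P2 f = bracket (L (f * ?c)) (P2 ?s) - bracket (L (f * ?s)) (P2 ?c)"
      using id2[of f] unfolding bracket_generators by (simp add: P2_def zero_prod_def)
    show "2 *\<^sub>R P2 f \<in> ?E"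
      unfolding eq by (intro subspace_diff[OF E] br)
  qed
  have J: "J f \<in> ?E" for f
  proof -
    have eq: "J f = bracket (L (f * ?c)) (J ?s) - bracket (L (f * ?s)) (J ?c)"
      using id1[of f] unfolding bracket_generators by (simp add: J_def zero_prod_def)
    show ?thesis
      unfolding eq by (intro subspace_diff[OF E] br)
  qed
  obtain f0 f1 f2 f3 \<alpha> \<beta> where X: "X = ((f0, f1, f2, f3), \<alpha>, \<beta>)"
    by (cases X) auto
  have "X \<in> ?E"
    unfolding X gca_decomposition
    by (intro subspace_add[OF E] subspace_scale[OF E] L P1 P2 J C)
  then show "A X = B X" by simp
qed

text \<open>Inverting the corrected \<open>Ad0 \<phi>\<close> expresses the correction through the
  Schwarzian of \<open>\<phi>\<close> itself, so no composition law for the Schwarzian of the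
  inverse has to be derived.\<close>

lemma Ad_diffeo_inv:
  "Ad (diffeo_inv \<phi>) (x, \<alpha>, \<beta>) = (Ad0 (diffeo_inv \<phi>) x, \<alpha> + schwarzian_form \<phi> x, \<beta>)"
proof -
  define A B :: "gca \<Rightarrow> gca"
    where "A = (\<lambda>X. (Ad0 \<phi> (fst X), fst (snd X) - schwarzian_form \<phi> (Ad0 \<phi> (fst X)), snd (snd X)))"
      and "B = (\<lambda>X. (Ad0 (diffeo_inv \<phi>) (fst X), fst (snd X) + schwarzian_form \<phi> (fst X), snd (snd X)))"
  have inv: "A (B X) = X" "B (A X) = X" for X
    by (simp_all add: A_def B_def Ad0_inv)
  have A_bracket: "A (bracket X Y) = bracket (A X) (A Y)" for X Y
    by (simp add: A_def bracket_def Ad0_bracket0[symmetric] cocycle1_Ad0 cocycle2_Ad0)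
  have "linear B"
    by (rule linearI)
      (simp_all add: B_def linear_add[OF linear_Ad0] linear_scale[OF linear_Ad0] prod_eq_iff
        linear_add[OF linear_schwarzian_form] linear_scale[OF linear_schwarzian_form] distrib_left)
  moreover have "bij B"
    using inv by (intro bijI') metis+
  \<comment> \<open>The inverse of a bracket-preserving bijection preserves brackets.\<close>
  moreover have "B (bracket X Y) = bracket (B X) (B Y)" for X Y
    by (metis A_bracket inv)
  ultimately have aut: "gca_automorphism B"
    by (simp add: gca_automorphism_def)
  have C: "B C1 = C1" "B C2 = C2"
    by (simp_all add: B_def C1_def C2_def Ad0_zero linear_0[OF linear_schwarzian_form])
  have fst: "fst (B X) = Ad0 (diffeo_inv \<phi>) (fst X)" for X
    by (simp add: B_def)
  have "Ad (diffeo_inv \<phi>) = B"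
    unfolding Ad_def
    by (rule the_equality) (use aut C fst in \<open>auto intro: automorphism_eqI\<close>)
  then show ?thesis
    by (simp add: B_def)
qed


section \<open>The coadjoint action\<close>

text \<open>Testing on elements with a single nonzero component isolates each coordinate; this gives
  uniqueness in the definition of \<open>coadjoint\<close>.\<close>

lemma pairing_nondegenerate:
  assumes "\<And>X. pairing \<eta> X = pairing \<zeta> X"
  shows "\<eta> = \<zeta>"
proof -
  obtain h0 h1 h2 h3 a b where \<eta>: "\<eta> = ((h0, h1, h2, h3), a, b)" by (cases \<eta>) auto
  obtain k0 k1 k2 k3 c d where \<zeta>: "\<zeta> = ((k0, k1, k2, k3), c, d)" by (cases \<zeta>) auto
  note eq = assms[unfolded \<eta> \<zeta>]
  have "h0 = k0" by (rule circle_integral_nondegenerate) (use eq[of "((_, 0, 0, 0), 0, 0)"] in simp)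
  moreover have "h1 = k1"
    by (rule circle_integral_nondegenerate) (use eq[of "((0, _, 0, 0), 0, 0)"] in simp)
  moreover have "h2 = k2"
    by (rule circle_integral_nondegenerate) (use eq[of "((0, 0, _, 0), 0, 0)"] in simp)
  moreover have "h3 = k3"
    by (rule circle_integral_nondegenerate) (use eq[of "((0, 0, 0, _), 0, 0)"] in simp)
  moreover have "a = c" "b = d"
    using eq[of "((0, 0, 0, 0), 1, 0)"] eq[of "((0, 0, 0, 0), 0, 1)"] by simp_all
  ultimately show ?thesis by (simp add: \<eta> \<zeta>)
qed

text \<open>Substitution along \<open>\<phi>\<close> undoes the inner pullback and leaves one
  derivative as Jacobian.\<close>

lemma integral_pullback_inv:
  "circle_integral (\<gamma> * pullback f (diffeo_inv \<phi>)) =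
    circle_integral (pullback \<gamma> \<phi> * diffeo_deriv \<phi> * f)"
  using circle_integral_pullback[of "\<gamma> * pullback f (diffeo_inv \<phi>)" \<phi>]
  by (simp add: pullback_mult pullback_inv mult_ac)

text \<open>Besides the Jacobian, undoing the pullback of a vector field along the inverse
  contributes a second derivative factor.\<close>

lemma integral_vec_pullback_inv:
  "circle_integral (\<gamma> * vec_pullback f (diffeo_inv \<phi>)) =
    circle_integral (pullback \<gamma> \<phi> * (diffeo_deriv \<phi>)\<^sup>2 * f)"
proof -
  have "pullback (vec_pullback f (diffeo_inv \<phi>)) \<phi> = f * diffeo_deriv \<phi>"
    by (metis vec_pullback_deriv vec_pullback_inv(1))
  then show ?thesis
    using circle_integral_pullback[of "\<gamma> * vec_pullback f (diffeo_inv \<phi>)" \<phi>]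
    by (simp add: pullback_mult power2_eq_square mult_ac)
qed

theorem proposition3:
  fixes \<phi> :: circle_diffeo and \<gamma>0 \<gamma>1 \<gamma>2 \<gamma>3 :: cinf and a b :: real
  shows "coadjoint \<phi> ((\<gamma>0, \<gamma>1, \<gamma>2, \<gamma>3), a, b) =
    ((a *\<^sub>R schwarzian \<phi> + pullback \<gamma>0 \<phi> * (diffeo_deriv \<phi>)\<^sup>2,
      pullback \<gamma>1 \<phi> * (diffeo_deriv \<phi>)\<^sup>2,
      pullback \<gamma>2 \<phi> * (diffeo_deriv \<phi>)\<^sup>2,
      pullback \<gamma>3 \<phi> * diffeo_deriv \<phi>),
     a, b)"
    (is "_ = ?\<eta>")
proof -
  have \<eta>: "pairing ?\<eta> X = pairing ((\<gamma>0, \<gamma>1, \<gamma>2, \<gamma>3), a, b) (Ad (diffeo_inv \<phi>) X)" for X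
  proof -
    obtain f0 f1 f2 f3 \<alpha> \<beta> where X: "X = ((f0, f1, f2, f3), \<alpha>, \<beta>)"
      by (cases X) auto
    \<comment> \<open>The summand \<open>a * schwarzian_form \<phi> x\<close> from the
      \<open>C1\<close> coordinate joins the integral against \<open>f0\<close>, which is where the
      Schwarzian enters the first component.\<close>
    show ?thesis
      unfolding X Ad_diffeo_inv
      by (simp only: Ad0.simps pairing.simps integral_pullback_inv integral_vec_pullback_inv
          schwarzian_form_def fst_conv distrib_right distrib_left mult_scaleR_left
          circle_integral_add circle_integral_scaleR)
  qed
  show ?thesis
    unfolding coadjoint_def
  proof (rule the_equality)
    show "\<forall>X. pairing ?\<eta> X = pairing ((\<gamma>0, \<gamma>1, \<gamma>2, \<gamma>3), a, b) (Ad (diffeo_inv \<phi>) X)"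
      using \<eta> by blast
    show "\<zeta> = ?\<eta>"
      if "\<forall>X. pairing \<zeta> X = pairing ((\<gamma>0, \<gamma>1, \<gamma>2, \<gamma>3), a, b) (Ad (diffeo_inv \<phi>) X)" for \<zeta>
      by (rule pairing_nondegenerate) (simp only: \<eta> that)
  qed
qed

end
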